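(* Let $X, Y \in \mathscr{M}_\lambda$, and assume that $\dim(X) = 0$ (Lebesgue covering dimension) if $\mu = \omega$. For every function $f \colon X \to Y$, the following are equivalent: (1) $f$ is $\lambda^+$-Borel measurable; (2) $f$ belongs to the $\mathcal{D}_0$-closure of the collection of all continuous functions from $X$ to $Y$; (3) $f$ belongs to the $\mathcal{D}_\lambda$-closure of the collection of all continuous functions from $X$ to $Y$.
   Context: Work in ZFC. $\lambda$ is an uncountable cardinal with $2^{<\lambda} = \lambda$, and $\mu = \operatorname{cof}(\lambda)$. All topological spaces are regular Hausdorff. Let $\mathbb{G} = \mathbb{R}$ if $\mu = \omega$; if $\mu > \omega$, $\mathbb{G}$ is a fixed ordered field whose positive part $\mathbb{G}^+$ has coinitiality $\mu$ (the paper uses the field of $\mu$-rationals; the choice is irrelevant). A $\mathbb{G}$-metric is a metric with values in $\mathbb{G}$; a space is $\mu$-metrizable if its topology is induced by a $\mathbb{G}$-metric. $\mathscr{M}_\lambda$ is the class of $\mu$-metrizable spaces of weight at most $\lambda$. A subset of a space $X$ is $\lambda^+$-Borel if it belongs to the smallest family containing the open sets and closed under complements and unions of size $\le\lambda$. A function $f\colon X\to Y$ is $\lambda^+$-Borel measurable if $f^{-1}(U)$ is $\lambda^+$-Borel for every open $U \subseteq Y$. For a directed set $D$, a point $x$ is the $D$-limit of a net $(x_d)_{d\in D}$ if for every open neighborhood $U$ of $x$ there is $d\in D$ with $x_{d'}\in U$ for all $d'\ge d$; for functions $f, f_d\colon X\to Y$, $f=\lim_{d\in D} f_d$ means $f(x)=\lim_{d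 \in D} f_d(x)$ for all $x\in X$. An ordinal (in particular a cardinal) is viewed as a directed set with its usual order. Given a family $\mathcal{D}$ of directed sets and a collection $\mathcal{F}$ of functions $X\to Y$, $\mathcal{F}$ is closed under $\mathcal{D}$-limits if for every $D\in\mathcal{D}$ and every family $(f_d)_{d\in D}$ from $\mathcal{F}$, $\lim_{d\in D} f_d \in \mathcal{F}$ whenever this pointwise limit exists; the $\mathcal{D}$-closure of $\mathcal{F}$ is the smallest collection containing $\mathcal{F}$ and closed under $\mathcal{D}$-limits. $\mathrm{Fin}_\lambda$ is the set of finite subsets of $\lambda$ ordered by inclusion. $\mathcal{D}_0 = \{\kappa \le \lambda \mid \kappa \text{ a regular cardinal}\} \cup \{\mathrm{Fin}_\lambda\}$, and $\mathcal{D}_\lambda$ is the class of all directed sets of cardinality at most $\lambda$. *)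

theory Defs
  imports "HOL-Analysis.Analysis"
begin

unbundle cardinal_syntax

section \<open>Cardinals\<close>

text \<open>A cardinal \<open>\<lambda>\<close> is a relation \<open>L\<close> with \<^prop>\<open>Card_order L\<close>.  The library predicate
  \<^const>\<open>cofinal\<close> asks for strictly larger elements; for orders without a largest element, the
  only ones used below, this is the usual notion.\<close>

definition cofinality :: "'a rel \<Rightarrow> 'a rel" where
  "cofinality r = |SOME A. A \<subseteq> Field r \<and> cofinal A r \<and>
                     (\<forall>B. B \<subseteq> Field r \<and> cofinal B r \<longrightarrow> |A| \<le>o |B| )|"

lemma cofinality_least:
  assumes "A \<subseteq> Field r" "cofinal A r"
  shows "\<exists>B. B \<subseteq> Field r \<and> cofinal B r \<and> |B| = cofinality r"
    and "cofinality r \<le>o |A|"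
proof -
  let ?S = "{A. A \<subseteq> Field r \<and> cofinal A r}"
  have "\<exists>p \<in> card_of ` ?S. \<forall>p' \<in> card_of ` ?S. p \<le>o p'"
    by (rule exists_minim_Well_order) (use assms card_of_Well_order in auto)
  then have "\<exists>A. A \<subseteq> Field r \<and> cofinal A r \<and>
               (\<forall>B. B \<subseteq> Field r \<and> cofinal B r \<longrightarrow> |A| \<le>o |B| )"
    by blast
  from someI_ex[OF this] assms
  show "\<exists>B. B \<subseteq> Field r \<and> cofinal B r \<and> |B| = cofinality r" "cofinality r \<le>o |A|"
    unfolding cofinality_def by blast+
qed

text \<open>\<open>2\<^bsup><\<lambda>\<^esup> = \<lambda>\<close>, where \<open>2\<^bsup><\<lambda>\<^esup>\<close> is the supremum of the cardinals \<open>2\<^bsup>\<kappa>\<^esup>\<close> for \<open>\<kappa> < \<lambda>\<close>.  Every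
  cardinal below \<open>\<lambda>\<close> is isomorphic to one on the type carrying \<open>\<lambda>\<close>, so it suffices to let
  \<open>\<kappa>\<close> and the competing upper bound \<open>\<rho>\<close> range over that type.\<close>

definition weak_power_two_eq :: "'l rel \<Rightarrow> bool" where
  "weak_power_two_eq L \<longleftrightarrow>
     (\<forall>\<kappa> :: 'l rel. Card_order \<kappa> \<and> \<kappa> <o L \<longrightarrow> ctwo ^c \<kappa> \<le>o L) \<and>
     (\<forall>\<rho> :: 'l rel. Card_order \<rho> \<and> (\<forall>\<kappa> :: 'l rel. Card_order \<kappa> \<and> \<kappa> <o L \<longrightarrow> ctwo ^c \<kappa> \<le>o \<rho>)
        \<longrightarrow> L \<le>o \<rho>)"

section \<open>The class of spaces\<close>

text \<open>The positive part of an ordered field with the reversed order, so that its cofinality is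
  the coinitiality of the positive part.\<close>

definition pos_reversed :: "'g::linordered_field itself \<Rightarrow> 'g rel" where
  "pos_reversed _ = {(a, b). 0 < b \<and> b \<le> a}"

definition field_metric :: "'a set \<Rightarrow> ('a \<Rightarrow> 'a \<Rightarrow> 'g::linordered_field) \<Rightarrow> bool" where
  "field_metric M d \<longleftrightarrow>
     (\<forall>x\<in>M. \<forall>y\<in>M. 0 \<le> d x y \<and> (d x y = 0 \<longleftrightarrow> x = y) \<and> d x y = d y x) \<and>
     (\<forall>x\<in>M. \<forall>y\<in>M. \<forall>z\<in>M. d x z \<le> d x y + d y z)"

definition field_metrizable :: "'g::linordered_field itself \<Rightarrow> 'a topology \<Rightarrow> bool" where
  "field_metrizable _ X \<longleftrightarrow>
     (\<exists>d :: 'a \<Rightarrow> 'a \<Rightarrow> 'g. field_metric (topspace X) d \<and>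
        (\<forall>U. openin X U \<longleftrightarrow> U \<subseteq> topspace X \<and>
               (\<forall>x\<in>U. \<exists>e>0. \<forall>y\<in>topspace X. d x y < e \<longrightarrow> y \<in> U)))"

text \<open>\<open>\<mu>\<close>-metrizability for \<open>\<mu> = cof \<lambda>\<close>; the field \<^typ>\<open>'g\<close> only matters for uncountable \<open>\<mu>\<close>.\<close>

definition mu_metrizable :: "'g::linordered_field itself \<Rightarrow> 'l rel \<Rightarrow> 'a topology \<Rightarrow> bool" where
  "mu_metrizable G L X \<longleftrightarrow>
     (if cofinality L =o natLeq then metrizable_space X else field_metrizable G X)"

definition weight_le :: "'a topology \<Rightarrow> 'l rel \<Rightarrow> bool" where
  "weight_le X L \<longleftrightarrow>
     (\<exists>\<B>. |\<B>| \<le>o L \<and> (\<forall>B\<in>\<B>. openin X B) \<and>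
        (\<forall>U x. openin X U \<and> x \<in> U \<longrightarrow> (\<exists>B\<in>\<B>. x \<in> B \<and> B \<subseteq> U)))"

definition class_M :: "'g::linordered_field itself \<Rightarrow> 'l rel \<Rightarrow> 'a topology \<Rightarrow> bool" where
  "class_M G L X \<longleftrightarrow> mu_metrizable G L X \<and> weight_le X L"

text \<open>Lebesgue covering dimension.  With values in \<^typ>\<open>enat\<close>, the empty space gets dimension
  \<open>0\<close> rather than \<open>-1\<close>.\<close>

definition covering_dim_le :: "'a topology \<Rightarrow> nat \<Rightarrow> bool" where
  "covering_dim_le X n \<longleftrightarrow>
     (\<forall>\<U>. finite \<U> \<and> (\<forall>U\<in>\<U>. openin X U) \<and> \<Union>\<U> = topspace X \<longrightarrow>
        (\<exists>\<V>. finite \<V> \<and> (\<forall>V\<in>\<V>. openin X V) \<and> \<Union>\<V> = topspace X \<and>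
           (\<forall>V\<in>\<V>. \<exists>U\<in>\<U>. V \<subseteq> U) \<and> (\<forall>x. card {V \<in> \<V>. x \<in> V} \<le> n + 1)))"

definition covering_dim :: "'a topology \<Rightarrow> enat" where
  "covering_dim X = Inf (enat ` {n. covering_dim_le X n})"

section \<open>Borel measurability\<close>

inductive_set lambda_borel_sets :: "'l rel \<Rightarrow> 'a topology \<Rightarrow> 'a set set"
  for L :: "'l rel" and X :: "'a topology" where
  "openin X U \<Longrightarrow> U \<in> lambda_borel_sets L X"
| "A \<in> lambda_borel_sets L X \<Longrightarrow> topspace X - A \<in> lambda_borel_sets L X"
| "|\<A>| \<le>o L \<Longrightarrow> (\<forall>A\<in>\<A>. A \<in> lambda_borel_sets L X) \<Longrightarrow> \<Union>\<A> \<in> lambda_borel_sets L X"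

definition lambda_borel_measurable :: "'l rel \<Rightarrow> 'a topology \<Rightarrow> 'b topology \<Rightarrow> ('a \<Rightarrow> 'b) \<Rightarrow> bool" where
  "lambda_borel_measurable L X Y f \<longleftrightarrow>
     (\<forall>U. openin Y U \<longrightarrow> {x \<in> topspace X. f x \<in> U} \<in> lambda_borel_sets L X)"

section \<open>Limits along directed sets\<close>

text \<open>A directed set is given by its (reflexive) order relation, with underlying set its field.\<close>

definition directed_rel :: "'d rel \<Rightarrow> bool" where
  "directed_rel D \<longleftrightarrow> Preorder D \<and> Field D \<noteq> {} \<and>
     (\<forall>a\<in>Field D. \<forall>b\<in>Field D. \<exists>c. (a, c) \<in> D \<and> (b, c) \<in> D)"

definition net_limit :: "'b topology \<Rightarrow> 'd rel \<Rightarrow> ('d \<Rightarrow> 'b) \<Rightarrow> 'b \<Rightarrow> bool" where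
  "net_limit Y D y l \<longleftrightarrow> l \<in> topspace Y \<and>
     (\<forall>U. openin Y U \<and> l \<in> U \<longrightarrow> (\<exists>d\<in>Field D. \<forall>d'. (d, d') \<in> D \<longrightarrow> y d' \<in> U))"

text \<open>Functions \<open>X \<rightarrow> Y\<close> are represented by the extensional functions between the underlying sets.\<close>

definition limit_closed ::
    "'a topology \<Rightarrow> 'b topology \<Rightarrow> 'd rel set \<Rightarrow> ('a \<Rightarrow> 'b) set \<Rightarrow> bool" where
  "limit_closed X Y \<D> \<F> \<longleftrightarrow>
     (\<forall>D\<in>\<D>. \<forall>g f. (\<forall>d\<in>Field D. g d \<in> \<F>) \<and> f \<in> topspace X \<rightarrow>\<^sub>E topspace Y \<and>
        (\<forall>x\<in>topspace X. net_limit Y D (\<lambda>d. g d x) (f x)) \<longrightarrow> f \<in> \<F>)"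

definition limit_closure ::
    "'a topology \<Rightarrow> 'b topology \<Rightarrow> 'd rel set \<Rightarrow> ('a \<Rightarrow> 'b) set \<Rightarrow> ('a \<Rightarrow> 'b) set" where
  "limit_closure X Y \<D> \<F> = limit_closed X Y \<D> hull \<F>"

definition continuous_functions :: "'a topology \<Rightarrow> 'b topology \<Rightarrow> ('a \<Rightarrow> 'b) set" where
  "continuous_functions X Y = {f \<in> topspace X \<rightarrow>\<^sub>E topspace Y. continuous_map X Y f}"

definition Fin_rel :: "'l rel \<Rightarrow> 'l set rel" where
  "Fin_rel L = {(A, B). A \<subseteq> B \<and> B \<subseteq> Field L \<and> finite B}"

text \<open>Both families consist of relations on \<^typ>\<open>'l set\<close>, where \<open>\<lambda>\<close> lives on \<^typ>\<open>'l\<close>: this type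
  contains \<open>Fin\<^sub>\<lambda>\<close> itself and an isomorphic copy of every ordered set of size at most \<open>\<lambda>\<close>.  The
  lemma below confirms that closure under limits does not depend on the chosen copies.\<close>

definition D_zero :: "'l rel \<Rightarrow> 'l set rel set" where
  "D_zero L = {\<kappa>. Cinfinite \<kappa> \<and> regularCard \<kappa> \<and> \<kappa> \<le>o L} \<union> {Fin_rel L}"

definition D_all :: "'l rel \<Rightarrow> 'l set rel set" where
  "D_all L = {D. directed_rel D \<and> |Field D| \<le>o L}"

lemma limit_closed_D_all_arbitrary_type:
  fixes L :: "'l rel" and D :: "'d rel"
  assumes L: "Card_order L" and D: "directed_rel D" "|Field D| \<le>o L"
    and cl: "limit_closed X Y (D_all L) \<F>"
  shows "limit_closed X Y {D} \<F>"
proof -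
  have "|Field D| \<le>o |Field L|"
    using D(2) card_of_Field_ordIso[OF L] ordIso_symmetric ordLeq_ordIso_trans by blast
  then obtain h0 where h0: "inj_on h0 (Field D)" "h0 ` Field D \<subseteq> Field L"
    using card_of_ordLeq by metis
  define h :: "'d \<Rightarrow> 'l set" where "h = (\<lambda>d. {h0 d})"
  have inj: "inj_on h (Field D)"
    using h0(1) by (auto simp: h_def inj_on_def)
  let ?E = "dir_image D h"
  have FE: "Field ?E = h ` Field D" by (rule dir_image_Field)
  have sub: "a \<in> Field D \<and> b \<in> Field D" if "(a, b) \<in> D" for a b
    using that by (auto simp: Field_def)
  have E: "(h a, h b) \<in> ?E \<longleftrightarrow> (a, b) \<in> D" if "a \<in> Field D" "b \<in> Field D" for a b
    using that sub inj unfolding dir_image_def inj_on_def by blast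
  have "Preorder ?E"
    unfolding preorder_on_def refl_on_def trans_def
  proof (intro conjI allI impI ballI subsetI)
    have refl: "(a, a) \<in> D" if "a \<in> Field D" for a
      using D(1) that unfolding directed_rel_def preorder_on_def refl_on_def by blast
    show "(x, x) \<in> ?E" if "x \<in> Field ?E" for x
      using that refl E by (auto simp: FE)
    show "(x, z) \<in> ?E" if xy: "(x, y) \<in> ?E" and yz: "(y, z) \<in> ?E" for x y z
    proof -
      obtain x' y' where *: "x = h x'" "y = h y'" "(x', y') \<in> D"
        using xy unfolding dir_image_def by blast
      obtain z' where **: "z = h z'" "z' \<in> Field D"
        using yz sub unfolding dir_image_def by blast
      have "(y', z') \<in> D" using yz * ** E[of y' z'] sub[OF *(3)] by simp
      then have "(x', z') \<in> D"
        using D(1) * unfolding directed_rel_def preorder_on_def trans_def by blast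
      then show ?thesis using *(1) **(1) unfolding dir_image_def by auto
    qed
  qed (auto intro: FieldI1 FieldI2)
  moreover have "\<exists>c. (a, c) \<in> ?E \<and> (b, c) \<in> ?E" if ab: "a \<in> Field ?E" "b \<in> Field ?E" for a b
  proof -
    obtain a' b' where *: "a = h a'" "b = h b'" "a' \<in> Field D" "b' \<in> Field D"
      using ab unfolding FE by blast
    then obtain c' where "(a', c') \<in> D" "(b', c') \<in> D"
      using D(1) unfolding directed_rel_def by blast
    then show ?thesis using *(1,2) unfolding dir_image_def by auto
  qed
  moreover have "|Field ?E| \<le>o L"
    unfolding FE by (rule ordLeq_transitive[OF card_of_image D(2)])
  ultimately have mem: "?E \<in> D_all L"
    using D(1) by (auto simp: D_all_def directed_rel_def FE)
  show ?thesis
    unfolding limit_closed_def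
  proof (intro ballI allI impI, elim conjE, simp)
    fix g f
    assume g: "\<forall>d\<in>Field D. g d \<in> \<F>" and f: "f \<in> topspace X \<rightarrow>\<^sub>E topspace Y"
      and lim: "\<forall>x\<in>topspace X. net_limit Y D (\<lambda>d. g d x) (f x)"
    define g' where "g' = (\<lambda>e. g (inv_into (Field D) h e))"
    have g'h: "g' (h d) = g d" if "d \<in> Field D" for d
      using that inj by (simp add: g'_def)
    have "net_limit Y ?E (\<lambda>e. g' e x) (f x)" if x: "x \<in> topspace X" for x
      unfolding net_limit_def
    proof (intro conjI allI impI)
      show "f x \<in> topspace Y" using f x by auto
      fix U assume "openin Y U \<and> f x \<in> U"
      then obtain d where d: "d \<in> Field D" "\<And>d'. (d, d') \<in> D \<Longrightarrow> g d' x \<in> U"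
        using lim x unfolding net_limit_def by blast
      have "g' e x \<in> U" if e: "(h d, e) \<in> ?E" for e
      proof -
        obtain e' where "e = h e'" "e' \<in> Field D"
          using e sub unfolding dir_image_def by blast
        then show ?thesis using e E[of d e'] d g'h[of e'] by simp
      qed
      then show "\<exists>d\<in>Field ?E. \<forall>d'. (d, d') \<in> ?E \<longrightarrow> g' d' x \<in> U"
        unfolding FE using d(1) by blast
    qed
    moreover have "\<forall>e\<in>Field ?E. g' e \<in> \<F>"
      unfolding FE using g g'h by simp
    ultimately show "f \<in> \<F>"
      using cl mem f unfolding limit_closed_def by blast
  qed
qed

end

theory Submission
  imports Defs
begin

text \<open>If \<open>f\<close> is the limit of \<open>\<lambda>\<^sup>+\<close>-Borel functions \<open>f\<^sub>d\<close> along a directed set of size at most \<open>\<lambda>\<close>, then \<open>f\<close>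
  maps a point into an open set \<open>U\<close> iff \<open>f\<^sub>d\<close> eventually maps it into some basic open set whose closure
  lies in \<open>U\<close>; so \<open>f\<close> is \<open>\<lambda>\<^sup>+\<close>-Borel.

  Conversely, consider the sets \<open>A\<close> such that the \<open>\<D>\<^sub>0\<close>-closure \<open>\<F>\<close> of the continuous functions contains,
  with \<open>g\<close> and \<open>h\<close>, the function equal to \<open>g\<close> on \<open>A\<close> and to \<open>h\<close> off \<open>A\<close>. Clopen sets have this property,
  and it passes to complements, to finite unions, and, by taking limits along \<open>Fin\<^sub>\<lambda>\<close>, to unions of size
  at most \<open>\<lambda>\<close>. As \<open>X\<close> has a clopen base and weight at most \<open>\<lambda>\<close>, all \<open>\<lambda>\<^sup>+\<close>-Borel sets have it. Another limit
  along \<open>Fin\<^sub>\<lambda>\<close> shows that \<open>\<F>\<close> contains every \<open>\<lambda>\<^sup>+\<close>-Borel function with at most \<open>\<lambda>\<close> values, and every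
  \<open>\<lambda>\<^sup>+\<close>-Borel function is a limit of such functions along the coinitiality of the positive part of the
  field, by sending \<open>x\<close> to the first point of a dense set that is close to \<open>f x\<close>.\<close>

section \<open>Closure under limits as a hull\<close>

lemma limit_closedD:
  assumes "limit_closed X Y \<D> \<F>" "D \<in> \<D>" "\<And>d. d \<in> Field D \<Longrightarrow> g d \<in> \<F>"
    "f \<in> topspace X \<rightarrow>\<^sub>E topspace Y"
    "\<And>x. x \<in> topspace X \<Longrightarrow> net_limit Y D (\<lambda>d. g d x) (f x)"
  shows "f \<in> \<F>"
  using assms(1)[unfolded limit_closed_def, rule_format, OF assms(2), of g f] assms(3-5) by simp

text \<open>Stability under intersections is what makes the \<open>hull\<close> in
  \<open>limit_closure\<close> itself closed under limits.\<close>

lemma limit_closed_Inter: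
  assumes "\<And>\<F>. \<F> \<in> \<S> \<Longrightarrow> limit_closed X Y \<D> \<F>"
  shows "limit_closed X Y \<D> (\<Inter>\<S>)"
  unfolding limit_closed_def
proof (intro ballI allI impI InterI, elim conjE)
  fix D g f \<F>
  assume "D \<in> \<D>" "\<F> \<in> \<S>" and g: "\<forall>d\<in>Field D. g d \<in> \<Inter>\<S>"
    and f: "f \<in> topspace X \<rightarrow>\<^sub>E topspace Y"
    and lim: "\<forall>x\<in>topspace X. net_limit Y D (\<lambda>d. g d x) (f x)"
  show "f \<in> \<F>"
    by (rule limit_closedD[OF assms[OF \<open>\<F> \<in> \<S>\<close>] \<open>D \<in> \<D>\<close> _ f, of g])
      (use g lim \<open>\<F> \<in> \<S>\<close> in auto)
qed

lemma limit_closed_limit_closure: "limit_closed X Y \<D> (limit_closure X Y \<D> \<F>)"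
  unfolding limit_closure_def hull_def by (rule limit_closed_Inter) simp

lemma subset_limit_closure: "\<F> \<subseteq> limit_closure X Y \<D> \<F>"
  unfolding limit_closure_def by (rule hull_subset)

lemma limit_closure_minimal:
  "\<F> \<subseteq> \<G> \<Longrightarrow> limit_closed X Y \<D> \<G> \<Longrightarrow> limit_closure X Y \<D> \<F> \<subseteq> \<G>"
  unfolding limit_closure_def by (rule hull_minimal)

lemma limit_closure_mono:
  assumes "\<D> \<subseteq> \<D>'"
  shows "limit_closure X Y \<D> \<F> \<subseteq> limit_closure X Y \<D>' \<F>"
proof (rule limit_closure_minimal[OF subset_limit_closure])
  show "limit_closed X Y \<D> (limit_closure X Y \<D>' \<F>)"
    using limit_closed_limit_closure[of X Y \<D>' \<F>] assms unfolding limit_closed_def by blast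
qed

lemma limit_closure_funcset:
  "limit_closure X Y \<D> (continuous_functions X Y) \<subseteq> topspace X \<rightarrow>\<^sub>E topspace Y"
  by (rule limit_closure_minimal) (auto simp: continuous_functions_def limit_closed_def)

section \<open>Finite subsets of a cardinal and the inclusion of \<open>D_zero\<close> in
  \<open>D_all\<close>\<close>

lemma Field_Fin_rel: "Field (Fin_rel L) = Fpow (Field L)"
  unfolding Fin_rel_def Field_def Fpow_def by (auto intro: finite_subset)

text \<open>Every set of size n + 1 arises by inserting an element into a set of size n. By
  induction each size class has at most \<open>|A|\<close> members, and there are only countably
  many classes.\<close>

lemma card_of_Fpow_ordLeq:
  assumes inf: "infinite A"
  shows "|Fpow A| \<le>o |A|"
proof -
  let ?T = "\<lambda>n. {s. s \<subseteq> A \<and> finite s \<and> card s = n}"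
  have "|?T n| \<le>o |A|" for n
  proof (induction n)
    case 0
    have "?T 0 = {{}}" by auto
    then show ?case using inf by (auto intro: card_of_singl_ordLeq)
  next
    case (Suc n)
    have "?T (Suc n) \<subseteq> (\<lambda>(a, s). insert a s) ` (A \<times> ?T n)"
    proof
      fix s assume s: "s \<in> ?T (Suc n)"
      then obtain a t where "s = insert a t" "a \<notin> t" "card t = n" "finite t"
        by (auto simp: card_Suc_eq_finite)
      then show "s \<in> (\<lambda>(a, s). insert a s) ` (A \<times> ?T n)"
        using s by (intro image_eqI[of _ _ "(a, t)"]) auto
    qed
    then have "|?T (Suc n)| \<le>o |A \<times> ?T n|"
      by (rule ordLeq_transitive[OF card_of_mono1 card_of_image])
    moreover have "|A \<times> ?T n| \<le>o |A|"
      by (rule card_of_Sigma_ordLeq_infinite[OF inf]) (simp_all add: Suc card_of_mono1)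
    ultimately show ?case by (rule ordLeq_transitive)
  qed
  then have "|\<Union>n. ?T n| \<le>o |A|"
    using inf by (intro card_of_UNION_ordLeq_infinite) (auto simp: infinite_iff_card_of_nat)
  moreover have "Fpow A = (\<Union>n. ?T n)" by (auto simp: Fpow_def)
  ultimately show ?thesis by simp
qed

text \<open>Finite sets are directed by unions, and in a linear order the larger of two elements
  bounds both.\<close>

lemma D_zero_subset_D_all:
  fixes L :: "'l rel"
  assumes L: "Cinfinite L"
  shows "D_zero L \<subseteq> D_all L"
proof -
  have LF: "|Field L| =o L" using L by (simp add: card_of_Field_ordIso)
  have inf: "infinite (Field L)" using L by (simp add: cinfinite_def)
  have "Fin_rel L \<in> D_all L"
  proof -
    have "Preorder (Fin_rel L)"
      unfolding preorder_on_def refl_on_def trans_def Field_Fin_rel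
      by (auto simp: Fin_rel_def Fpow_def intro: finite_subset)
    moreover have "{} \<in> Field (Fin_rel L)" by (simp add: Field_Fin_rel Fpow_def)
    moreover have "\<exists>C. (A, C) \<in> Fin_rel L \<and> (B, C) \<in> Fin_rel L"
      if "A \<in> Field (Fin_rel L)" "B \<in> Field (Fin_rel L)" for A B
      by (rule exI[of _ "A \<union> B"]) (use that[unfolded Field_Fin_rel] in \<open>auto simp: Fpow_def Fin_rel_def\<close>)
    moreover have "|Field (Fin_rel L)| \<le>o L"
      unfolding Field_Fin_rel
      using card_of_Fpow_ordLeq[OF inf] LF ordLeq_ordIso_trans by blast
    ultimately show ?thesis unfolding D_all_def directed_rel_def by blast
  qed
  moreover have "\<kappa> \<in> D_all L" if k: "Cinfinite \<kappa>" "\<kappa> \<le>o L" for \<kappa> :: "'l set rel"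
  proof -
    have W: "Well_order \<kappa>" using k(1) by (simp add: card_order_on_def)
    then have lin: "Preorder \<kappa>" "Total \<kappa>" "Refl \<kappa>"
      by (auto simp: order_on_defs)
    have "Field \<kappa> \<noteq> {}" using k(1) by (auto simp: cinfinite_def)
    moreover have "\<exists>c. (a, c) \<in> \<kappa> \<and> (b, c) \<in> \<kappa>" if "a \<in> Field \<kappa>" "b \<in> Field \<kappa>" for a b
      using lin that unfolding total_on_def refl_on_def by metis
    moreover have "|Field \<kappa>| \<le>o L"
      using k card_of_Field_ordIso ordIso_ordLeq_trans by blast
    ultimately show ?thesis using lin unfolding D_all_def directed_rel_def by blast
  qed
  ultimately show ?thesis unfolding D_zero_def by blast
qed

section \<open>Borel sets\<close>

lemma lambda_borel_sets_subset: "A \<in> lambda_borel_sets L X \<Longrightarrow> A \<subseteq> topspace X"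
  by (induction rule: lambda_borel_sets.induct) (auto dest: openin_subset)

lemma lambda_borel_sets_UN:
  assumes "|I| \<le>o L" "\<And>i. i \<in> I \<Longrightarrow> A i \<in> lambda_borel_sets L X"
  shows "(\<Union>i\<in>I. A i) \<in> lambda_borel_sets L X"
  by (rule lambda_borel_sets.intros(3))
    (use assms ordLeq_transitive[OF card_of_image assms(1)] in auto)

text \<open>For nonempty \<open>I\<close> the intersection stays inside the space, so De Morgan's
  law relative to \<open>topspace X\<close> applies.\<close>

lemma lambda_borel_sets_INT:
  assumes "|I| \<le>o L" "\<And>i. i \<in> I \<Longrightarrow> A i \<in> lambda_borel_sets L X" "I \<noteq> {}"
  shows "(\<Inter>i\<in>I. A i) \<in> lambda_borel_sets L X"
proof -
  have "(\<Inter>i\<in>I. A i) = topspace X - (\<Union>i\<in>I. topspace X - A i)"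
    using assms(2,3) lambda_borel_sets_subset by fastforce
  moreover have "(\<Union>i\<in>I. topspace X - A i) \<in> lambda_borel_sets L X"
    using assms by (intro lambda_borel_sets_UN lambda_borel_sets.intros(2))
  ultimately show ?thesis using lambda_borel_sets.intros(2) by metis
qed

text \<open>The difference is the intersection of \<open>A\<close> with the complement of
  \<open>B\<close>, and a family of at most two sets is smaller than the infinite cardinal
  \<open>L\<close>.\<close>

lemma lambda_borel_sets_Diff:
  assumes L: "Cinfinite L" and A: "A \<in> lambda_borel_sets L X" and B: "B \<in> lambda_borel_sets L X"
  shows "A - B \<in> lambda_borel_sets L X"
proof -
  have "|{A, topspace X - B}| \<le>o L"
    using ordLess_imp_ordLeq[OF finite_ordLess_infinite[
        OF card_of_Well_order[of "{A, topspace X - B}"], of L]] L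
    by (simp add: cinfinite_def Field_card_of card_order_on_def)
  then have "(\<Inter>C\<in>{A, topspace X - B}. C) \<in> lambda_borel_sets L X"
    by (rule lambda_borel_sets_INT) (use A B lambda_borel_sets.intros(2) in auto)
  moreover have "(\<Inter>C\<in>{A, topspace X - B}. C) = A - B"
    using lambda_borel_sets_subset[OF A] by auto
  ultimately show ?thesis by simp
qed

section \<open>Field-valued metrics and clopen bases\<close>

text \<open>The body of \<open>field_metrizable\<close> with the metric as a parameter, so that one
  metric can be fixed and reused.\<close>

definition induces_topology ::
    "('a \<Rightarrow> 'a \<Rightarrow> 'g::linordered_field) \<Rightarrow> 'a topology \<Rightarrow> bool" where
  "induces_topology d X \<longleftrightarrow> field_metric (topspace X) d \<and>
     (\<forall>U. openin X U \<longleftrightarrow> U \<subseteq> topspace X \<and>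
        (\<forall>x\<in>U. \<exists>e>0. \<forall>y\<in>topspace X. d x y < e \<longrightarrow> y \<in> U))"

lemma field_metrizable_iff:
  "field_metrizable TYPE('g::linordered_field) X
     \<longleftrightarrow> (\<exists>d :: 'a \<Rightarrow> 'a \<Rightarrow> 'g. induces_topology d X)"
  unfolding field_metrizable_def induces_topology_def ..

text \<open>Real metrics are brought into the form used for arbitrary ordered fields, so that
  countable and uncountable cofinality share one argument.\<close>

lemma metrizable_space_imp_field_metrizable:
  assumes "metrizable_space X"
  shows "field_metrizable TYPE(real) X"
proof -
  obtain M d where M: "Metric_space M d" "X = Metric_space.mtopology M d"
    using assms unfolding metrizable_space_def by blast
  interpret Metric_space M d by (rule M)
  have "field_metric M d"
    unfolding field_metric_def using commute triangle by auto
  moreover have "(\<exists>r>0. mball x r \<subseteq> U) \<longleftrightarrow> (\<exists>e>0. \<forall>y\<in>M. d x y < e \<longrightarrow> y \<in> U)"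
    if "U \<subseteq> M" "x \<in> U" for x U
    using that unfolding mball_def by auto
  ultimately have "induces_topology d X"
    unfolding induces_topology_def M(2) topspace_mtopology openin_mtopology by blast
  then show ?thesis unfolding field_metrizable_iff by blast
qed

context
  fixes d :: "'a \<Rightarrow> 'a \<Rightarrow> 'g::linordered_field" and X :: "'a topology"
  assumes d: "induces_topology d X"
begin

lemma induces_topology_metric:
  assumes "x \<in> topspace X" "y \<in> topspace X"
  shows "0 \<le> d x y" "d x y = 0 \<longleftrightarrow> x = y" "d x y = d y x"
  using d assms unfolding induces_topology_def field_metric_def by blast+

lemma induces_topology_triangle:
  assumes "x \<in> topspace X" "y \<in> topspace X" "z \<in> topspace X"
  shows "d x z \<le> d x y + d y z"
  using d assms unfolding induces_topology_def field_metric_def by blast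

lemma openin_induces_topology:
  "openin X U \<longleftrightarrow> U \<subseteq> topspace X \<and>
     (\<forall>x\<in>U. \<exists>e>0. \<forall>y\<in>topspace X. d x y < e \<longrightarrow> y \<in> U)"
  using d unfolding induces_topology_def by blast

lemma openin_induces_ball:
  assumes x: "x \<in> topspace X"
  shows "openin X {y \<in> topspace X. d x y < e}"
  unfolding openin_induces_topology
proof (intro conjI ballI)
  fix y assume y: "y \<in> {y \<in> topspace X. d x y < e}"
  have "d x z < e" if "z \<in> topspace X" "d y z < e - d x y" for z
    using induces_topology_triangle[of x y z] x y that by (simp add: algebra_simps)
  then show "\<exists>e'>0. \<forall>z\<in>topspace X. d y z < e' \<longrightarrow> z \<in> {y \<in> topspace X. d x y < e}"
    using y by (intro exI[of _ "e - d x y"]) auto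
qed auto

lemma closedin_induces_cball:
  assumes x: "x \<in> topspace X"
  shows "closedin X {y \<in> topspace X. d x y \<le> e}"
  unfolding closedin_def openin_induces_topology
proof (intro conjI ballI)
  fix y assume y: "y \<in> topspace X - {y \<in> topspace X. d x y \<le> e}"
  have "\<not> d x z \<le> e" if "z \<in> topspace X" "d y z < d x y - e" for z
    using induces_topology_triangle[of x z y] induces_topology_metric(3)[of y z] x y that
    by (simp add: algebra_simps)
  then show "\<exists>e'>0. \<forall>z\<in>topspace X. d y z < e' \<longrightarrow> z \<in> topspace X - {y \<in> topspace X. d x y \<le> e}"
    using y by (intro exI[of _ "d x y - e"]) auto
qed auto

text \<open>The open and the closed ball of radius \<open>e / 2\<close> are nested and both fit into
  the ball of radius \<open>e\<close>.\<close>

lemma induces_topology_regular: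
  assumes U: "openin X U" "x \<in> U"
  shows "\<exists>V C. openin X V \<and> closedin X C \<and> x \<in> V \<and> V \<subseteq> C \<and> C \<subseteq> U"
proof -
  have x: "x \<in> topspace X" using U openin_subset by blast
  obtain e where e: "e > 0" "\<forall>y\<in>topspace X. d x y < e \<longrightarrow> y \<in> U"
    using U unfolding openin_induces_topology by blast
  let ?V = "{y \<in> topspace X. d x y < e / 2}" and ?C = "{y \<in> topspace X. d x y \<le> e / 2}"
  have "e / 2 < e" "0 < e / 2" using e(1) by simp_all
  then have "x \<in> ?V" "?V \<subseteq> ?C" "?C \<subseteq> U"
    using e(2) x induces_topology_metric(2)[of x x] by auto
  moreover have "openin X ?V" "closedin X ?C"
    by (rule openin_induces_ball[OF x], rule closedin_induces_cball[OF x])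
  ultimately show ?thesis by (intro exI[of _ ?V] exI[of _ ?C]) simp
qed

text \<open>If no sequence is coinitial in the positive part of the field, the intersection of the balls
  of radius \<open>e / 2 ^ n\<close> around a point is clopen, since it contains a ball around each of its points
  and so does its complement.\<close>

lemma induces_topology_clopen_base:
  assumes unc: "\<And>s :: nat \<Rightarrow> 'g. (\<And>n. 0 < s n) \<Longrightarrow> \<exists>\<delta>>0. \<forall>n. \<delta> \<le> s n"
    and U: "openin X U" "x \<in> U"
  shows "\<exists>V. openin X V \<and> closedin X V \<and> x \<in> V \<and> V \<subseteq> U"
proof -
  have x: "x \<in> topspace X" using U openin_subset by blast
  obtain e where e: "e > 0" "\<forall>y\<in>topspace X. d x y < e \<longrightarrow> y \<in> U"
    using U unfolding openin_induces_topology by blast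
  define s where "s = (\<lambda>n::nat. e / 2 ^ n)"
  have s: "0 < s n" "s (Suc n) + s (Suc n) = s n" for n
    using e(1) by (simp_all add: s_def)
  obtain \<delta> where \<delta>: "\<delta> > 0" "\<And>n. \<delta> \<le> s n" using unc[of s] s(1) by blast
  let ?V = "{y \<in> topspace X. \<forall>n. d x y < s n}"
  \<comment> \<open>The bound \<open>s n\<close> is split into equal halves: \<open>y\<close> is
    within \<open>s (Suc n)\<close> of \<open>x\<close>, and \<open>z\<close> is within \<delta>
    \<le> \<open>s (Suc n)\<close> of \<open>y\<close>.\<close>
  have near: "z \<in> ?V" if "y \<in> ?V" "z \<in> topspace X" "d y z < \<delta>" for y z
  proof -
    have "d x z < s n" for n
    proof -
      have "d x z \<le> d x y + d y z" using induces_topology_triangle x that by blast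
      also have "\<dots> < s (Suc n) + s (Suc n)"
        using that \<delta>(2)[of "Suc n"] by (intro add_strict_mono) auto
      finally show ?thesis by (simp add: s(2))
    qed
    then show ?thesis using that by blast
  qed
  have "openin X ?V"
    unfolding openin_induces_topology using near \<delta>(1) by blast
  moreover have "openin X (topspace X - ?V)"
    unfolding openin_induces_topology
  proof (intro conjI ballI)
    fix y assume y: "y \<in> topspace X - ?V"
    \<comment> \<open>By symmetry of \<open>d\<close>, a point of \<open>?V\<close> this close to
      \<open>y\<close> would put \<open>y\<close> into \<open>?V\<close> as well.\<close>
    have "z \<notin> ?V" if "z \<in> topspace X" "d y z < \<delta>" for z
      using near[of z y] y that induces_topology_metric(3)[of y z] by auto
    then show "\<exists>e>0. \<forall>z\<in>topspace X. d y z < e \<longrightarrow> z \<in> topspace X - ?V"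
      using \<delta>(1) by blast
  qed auto
  moreover have "x \<in> ?V" using x s(1) induces_topology_metric(2)[of x x] by simp
  moreover have "?V \<subseteq> U" using e(2) by (auto simp: s_def dest: spec[of _ 0])
  ultimately show ?thesis unfolding closedin_def by blast
qed

end

text \<open>Refine the cover by \<open>U\<close> and the complement of \<open>x\<close>, which is
  open by T1. In dimension 0 the refinement is a partition into open sets, so its member containing
  \<open>x\<close> is clopen, and it can only lie in \<open>U\<close>.\<close>

lemma covering_dim_zero_clopen_base:
  assumes dim: "covering_dim X = 0" and T1: "t1_space X" and U: "openin X U" "x \<in> U"
  shows "\<exists>V. openin X V \<and> closedin X V \<and> x \<in> V \<and> V \<subseteq> U"
proof -
  have x: "x \<in> topspace X" using U openin_subset by blast
  have "covering_dim_le X 0"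
  proof (rule ccontr)
    assume "\<not> covering_dim_le X 0"
    \<comment> \<open>If 0 is not an admissible bound, then all admissible bounds are at least 1,
      and so is their infimum, even when there are none.\<close>
    then have "1 \<le> enat n" if "covering_dim_le X n" for n
      using that by (cases n) (auto simp: one_enat_def)
    then have "1 \<le> covering_dim X"
      unfolding covering_dim_def by (auto intro!: Inf_greatest)
    then show False using dim by simp
  qed
  moreover have "openin X (topspace X - {x})"
    using T1 x by (simp add: t1_space_closedin_singleton openin_diff)
  ultimately obtain \<V> where \<V>: "finite \<V>" "\<forall>V\<in>\<V>. openin X V" "\<Union>\<V> = topspace X"
      "\<forall>V\<in>\<V>. \<exists>W\<in>{U, topspace X - {x}}. V \<subseteq> W" "\<forall>y. card {V \<in> \<V>. y \<in> V} \<le> 1"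
    using U openin_subset[OF U(1)] unfolding covering_dim_le_def
    by (elim allE[of _ "{U, topspace X - {x}}"]) auto
  obtain V where V: "V \<in> \<V>" "x \<in> V" using \<V>(3) x by blast
  then have "V \<subseteq> U" using \<V>(4) by blast
  have disj: "V' \<inter> V = {}" if "V' \<in> \<V>" "V' \<noteq> V" for V'
  proof (rule ccontr)
    assume "V' \<inter> V \<noteq> {}"
    then obtain y where "y \<in> V'" "y \<in> V" by blast
    then have "{V, V'} \<subseteq> {W \<in> \<V>. y \<in> W}" using V that by blast
    then have "card {V, V'} \<le> card {W \<in> \<V>. y \<in> W}" using \<V>(1) by (intro card_mono) auto
    then show False using \<V>(5)[rule_format, of y] that(2) by (auto simp: card_insert_if)
  qed
  have "topspace X - V = \<Union>(\<V> - {V})" using disj \<V>(3) by blast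
  then have "openin X (topspace X - V)" using \<V>(2) by auto
  then have "closedin X V" unfolding closedin_def using V \<V> by blast
  then show ?thesis using V \<V>(2) \<open>V \<subseteq> U\<close> by blast
qed

section \<open>Coinitiality of the positive part\<close>

lemma pos_reversed_Field: "Field (pos_reversed TYPE('g::linordered_field)) = {x. 0 < x}"
  unfolding pos_reversed_def Field_def by auto

text \<open>The inequality \<open>a < e\<close> is strict because \<open>cofinal\<close> asks for an
  element different from the given one.\<close>

lemma pos_reversed_cofinal:
  "cofinal A (pos_reversed TYPE('g::linordered_field)) \<longleftrightarrow> (\<forall>e>0. \<exists>a\<in>A. 0 < a \<and> a < e)"
  unfolding cofinal_def pos_reversed_Field unfolding pos_reversed_def by force

text \<open>Halving shows that the positive part is cofinal in itself in the strict sense, so the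
  minimum defining \<open>cofinality\<close> is attained.\<close>

lemma pos_reversed_cofinality_witness:
  "\<exists>B. B \<subseteq> {x. 0 < x} \<and> cofinal B (pos_reversed TYPE('g::linordered_field)) \<and>
       |B| = cofinality (pos_reversed TYPE('g))"
proof -
  have "\<exists>a\<in>{x. 0 < x}. 0 < a \<and> a < e" if "0 < e" for e :: 'g
    using that by (intro bexI[of _ "e / 2"]) simp_all
  then have "cofinal {x. 0 < x} (pos_reversed TYPE('g))"
    unfolding pos_reversed_cofinal by blast
  from cofinality_least(1)[OF _ this] show ?thesis unfolding pos_reversed_Field by blast
qed

lemma pos_reversed_cofinal_infinite:
  assumes "B \<subseteq> {x. 0 < x}" and cof: "cofinal B (pos_reversed TYPE('g::linordered_field))"
  shows "infinite B"
proof
  assume fin: "finite B"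
  have "B \<noteq> {}" using cof zero_less_one unfolding pos_reversed_cofinal by blast
  then have "Min B \<in> B" using fin by simp
  then obtain a where "a \<in> B" "a < Min B"
    using cof assms(1) unfolding pos_reversed_cofinal by blast
  then show False using fin Min_le leD by blast
qed

text \<open>This supplies radii tending to 0 along an admissible index. A coinitial set of least
  size is enumerated along its cardinal \<kappa>. The values at indices before \<open>i\<close> are
  too few to be coinitial, which leaves room for a positive \<open>\<epsilon> i\<close> below all
  values up to \<open>i\<close>.\<close>

lemma regular_index_of_pos_reversed:
  fixes L :: "'l rel"
  assumes L: "Card_order L" and le: "cofinality (pos_reversed TYPE('g::linordered_field)) \<le>o L"
  obtains \<kappa> :: "'l set rel" and \<epsilon> :: "'l set \<Rightarrow> 'g::linordered_field"
  where "\<kappa> \<in> D_zero L" "\<And>i. i \<in> Field \<kappa> \<Longrightarrow> 0 < \<epsilon> i"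
    "\<And>e. 0 < e \<Longrightarrow> \<exists>i\<in>Field \<kappa>. \<forall>j. (i, j) \<in> \<kappa> \<longrightarrow> \<epsilon> j < e"
proof -
  let ?r = "pos_reversed TYPE('g)"
  obtain B where B: "B \<subseteq> {x. 0 < x}" "cofinal B ?r" "|B| = cofinality ?r"
    using pos_reversed_cofinality_witness by blast
  have "|B| \<le>o |Field L|"
    using le B(3) card_of_Field_ordIso[OF L] ordIso_symmetric ordLeq_ordIso_trans by metis
  then obtain h0 where h0: "inj_on h0 B" "h0 ` B \<subseteq> Field L"
    using card_of_ordLeq by metis
  \<comment> \<open>Singletons move the index into \<open>'l set\<close>, the type that carries the
    relations in \<open>D_zero\<close>.\<close>
  define h :: "'g \<Rightarrow> 'l set" where "h = (\<lambda>b. {h0 b})"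
  have h: "inj_on h B" using h0(1) by (auto simp: h_def inj_on_def)
  define \<kappa> where "\<kappa> = |h ` B|"
  define a where "a = inv_into B h"
  have F: "Field \<kappa> = h ` B" by (simp only: \<kappa>_def Field_card_of)
  have a: "a i \<in> B" if "i \<in> Field \<kappa>" for i
    using that unfolding F a_def by (rule inv_into_into)
  have ah: "a (h b) = b" if "b \<in> B" for b using that h by (simp add: a_def)
  have card: "Card_order \<kappa>" unfolding \<kappa>_def by (rule card_of_Card_order)
  have iso: "\<kappa> =o cofinality ?r"
    unfolding \<kappa>_def B(3)[symmetric]
    using card_of_ordIso h ordIso_symmetric bij_betw_imageI by blast
  have "\<exists>x>0. \<forall>j. (j, i) \<in> \<kappa> \<longrightarrow> x < a j" if i: "i \<in> Field \<kappa>" for i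
  proof -
    have "|underS \<kappa> i| <o \<kappa>" by (rule card_of_underS[OF card i])
    then have "|a ` underS \<kappa> i| <o cofinality ?r"
      using card_of_image iso ordLeq_ordLess_trans ordLess_ordIso_trans by blast
    moreover have sub: "a ` underS \<kappa> i \<subseteq> {x. 0 < x}"
      using a B(1) underS_Field[of _ \<kappa> i] by fastforce
    ultimately have "\<not> cofinal (a ` underS \<kappa> i) ?r"
      using cofinality_least(2)[of "a ` underS \<kappa> i" ?r] unfolding pos_reversed_Field
      using not_ordLess_ordLeq by blast
    then obtain e where e: "0 < e" "\<forall>j\<in>underS \<kappa> i. \<not> a j < e"
      using sub unfolding pos_reversed_cofinal by blast
    have pos: "0 < a i" using a[OF i] B(1) by blast
    \<comment> \<open>\<open>underS\<close> omits \<open>i\<close> itself, hence the minimum with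
      \<open>a i\<close>; halving makes the bound strict.\<close>
    let ?x = "min e (a i) / 2"
    have "0 < ?x" "?x < e" "?x < a i" using e(1) pos by (auto simp: min_def)
    moreover have "?x < a j" if "(j, i) \<in> \<kappa>" for j
    proof (cases "j = i")
      case False
      then have "e \<le> a j" using that e(2) by (force simp: underS_def)
      then show ?thesis using \<open>?x < e\<close> by simp
    qed (use \<open>?x < a i\<close> in simp)
    ultimately show ?thesis by blast
  qed
  then obtain \<epsilon> where \<epsilon>: "\<And>i. i \<in> Field \<kappa> \<Longrightarrow> 0 < \<epsilon> i \<and> (\<forall>j. (j, i) \<in> \<kappa> \<longrightarrow> \<epsilon> i < a j)"
    by metis
  \<comment> \<open>From the index of some \<open>b < e\<close> onwards, \<open>\<epsilon> j\<close>
    lies below \<open>b\<close>, since \<open>b\<close> is among the values up to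
    \<open>j\<close>.\<close>
  have conv: "\<exists>i\<in>Field \<kappa>. \<forall>j. (i, j) \<in> \<kappa> \<longrightarrow> \<epsilon> j < e" if e: "0 < e" for e :: 'g
  proof -
    obtain b where b: "b \<in> B" "b < e" using B(2) e unfolding pos_reversed_cofinal by blast
    have "\<epsilon> j < e" if "(h b, j) \<in> \<kappa>" for j
      using \<epsilon>[of j] that b ah[OF b(1)] by (metis FieldI2 less_trans)
    then show ?thesis using b(1) F by blast
  qed
  have "regularCard \<kappa>"
    unfolding regularCard_def
  proof (intro allI impI, elim conjE)
    fix K assume K: "K \<subseteq> Field \<kappa>" "cofinal K \<kappa>"
    \<comment> \<open>Regularity: \<epsilon> carries a cofinal \<open>K\<close> to a coinitial set
      of positive elements, so \<open>K\<close> has at least the size of the coinitiality, which is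
      \<kappa>.\<close>
    have "\<exists>x\<in>\<epsilon> ` K. 0 < x \<and> x < e" if "0 < e" for e
    proof -
      obtain i where i: "i \<in> Field \<kappa>" "\<forall>j. (i, j) \<in> \<kappa> \<longrightarrow> \<epsilon> j < e"
        using conv[OF \<open>0 < e\<close>] by blast
      obtain k where k: "k \<in> K" "(i, k) \<in> \<kappa>" using K(2) i(1) unfolding cofinal_def by blast
      have "0 < \<epsilon> k" "\<epsilon> k < e" using \<epsilon> K(1) k i(2) by blast+
      then show ?thesis using k(1) by blast
    qed
    then have "cofinal (\<epsilon> ` K) ?r" unfolding pos_reversed_cofinal by blast
    moreover have "\<epsilon> ` K \<subseteq> Field ?r" using K(1) \<epsilon> unfolding pos_reversed_Field by blast
    ultimately have "cofinality ?r \<le>o |\<epsilon> ` K|" by (intro cofinality_least)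
    then have "\<kappa> \<le>o |K|"
      using iso card_of_image ordLeq_transitive ordIso_ordLeq_trans by blast
    moreover have "|K| \<le>o \<kappa>"
      using card_of_mono1[OF K(1)] card_of_Field_ordIso[OF card] ordLeq_ordIso_trans by blast
    ultimately show "|K| =o \<kappa>" by (simp add: ordIso_iff_ordLeq)
  qed
  moreover have "infinite (Field \<kappa>)"
    unfolding F using pos_reversed_cofinal_infinite[OF B(1,2)] h by (simp add: finite_image_iff)
  moreover have "\<kappa> \<le>o L" using iso le ordIso_ordLeq_trans by blast
  ultimately have "\<kappa> \<in> D_zero L" using card unfolding D_zero_def cinfinite_def by blast
  then show thesis using \<epsilon> conv that by blast
qed

section \<open>Limits of Borel functions are Borel\<close>

text \<open>One point is chosen from each nonempty member of a small base. The approximating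
  functions will take their values in this set.\<close>

lemma weight_le_dense:
  assumes "weight_le Z L"
  obtains D where "D \<subseteq> topspace Z" "|D| \<le>o L"
    "\<And>U z. openin Z U \<Longrightarrow> z \<in> U \<Longrightarrow> \<exists>w\<in>D. w \<in> U"
proof -
  obtain \<B> where B: "|\<B>| \<le>o L" "\<And>B. B \<in> \<B> \<Longrightarrow> openin Z B"
      "\<And>U x. openin Z U \<Longrightarrow> x \<in> U \<Longrightarrow> \<exists>B\<in>\<B>. x \<in> B \<and> B \<subseteq> U"
    using assms unfolding weight_le_def by metis
  let ?D = "(\<lambda>B. SOME w. w \<in> B) ` {B \<in> \<B>. B \<noteq> {}}"
  have some: "(SOME w. w \<in> B) \<in> B" if "B \<noteq> {}" for B :: "'a set"
    using that by (simp add: some_in_eq)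
  have "|?D| \<le>o L"
    by (rule ordLeq_transitive[OF card_of_image ordLeq_transitive[OF card_of_mono1 B(1)]]) blast
  moreover have "?D \<subseteq> topspace Z" using some B(2) openin_subset by blast
  moreover have "\<exists>w\<in>?D. w \<in> U" if U: "openin Z U" "z \<in> U" for U z
  proof -
    obtain B where "B \<in> \<B>" "z \<in> B" "B \<subseteq> U" using B(3) U by blast
    then show ?thesis using some[of B] by blast
  qed
  ultimately show thesis by (intro that[of ?D])
qed

text \<open>Only those base members are kept that have a closed set between them and
  \<open>U\<close>; by regularity they still cover \<open>U\<close>. The closed set keeps limits of
  nets inside \<open>U\<close>.\<close>

lemma weight_le_regular_base:
  assumes w: "weight_le Y L"
    and reg: "\<And>U y. openin Y U \<Longrightarrow> y \<in> U \<Longrightarrow>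
                \<exists>V C. openin Y V \<and> closedin Y C \<and> y \<in> V \<and> V \<subseteq> C \<and> C \<subseteq> U"
    and U: "openin Y U"
  obtains \<B> where "|\<B>| \<le>o L" "\<And>B. B \<in> \<B> \<Longrightarrow> openin Y B \<and> (\<exists>C. closedin Y C \<and> B \<subseteq> C \<and> C \<subseteq> U)"
    "\<And>y. y \<in> U \<Longrightarrow> \<exists>B\<in>\<B>. y \<in> B"
proof -
  obtain \<B> where B: "|\<B>| \<le>o L" "\<And>B. B \<in> \<B> \<Longrightarrow> openin Y B"
      "\<And>U x. openin Y U \<Longrightarrow> x \<in> U \<Longrightarrow> \<exists>B\<in>\<B>. x \<in> B \<and> B \<subseteq> U"
    using w unfolding weight_le_def by metis
  let ?B = "{B \<in> \<B>. \<exists>C. closedin Y C \<and> B \<subseteq> C \<and> C \<subseteq> U}"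
  have "|?B| \<le>o L" using card_of_mono1[of ?B \<B>] B(1) ordLeq_transitive by blast
  moreover have "\<exists>B\<in>?B. y \<in> B" if y: "y \<in> U" for y
  proof -
    obtain V C where VC: "openin Y V" "closedin Y C" "y \<in> V" "V \<subseteq> C" "C \<subseteq> U"
      using reg[OF U y] by blast
    then obtain B where "B \<in> \<B>" "y \<in> B" "B \<subseteq> V" using B(3) by blast
    then show ?thesis using VC by blast
  qed
  ultimately show thesis using that[of ?B] B(2) by blast
qed

lemma limit_closed_lambda_borel_measurable:
  fixes L :: "'l rel" and X :: "'x topology" and Y :: "'y topology"
  assumes w: "weight_le Y L"
    and reg: "\<And>U y. openin Y U \<Longrightarrow> y \<in> U \<Longrightarrow>
                \<exists>V C. openin Y V \<and> closedin Y C \<and> y \<in> V \<and> V \<subseteq> C \<and> C \<subseteq> U"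
  shows "limit_closed X Y (D_all L)
           {f \<in> topspace X \<rightarrow>\<^sub>E topspace Y. lambda_borel_measurable L X Y f}"
  unfolding limit_closed_def
proof (intro ballI allI impI, elim conjE)
  fix D and g :: "'l set \<Rightarrow> 'x \<Rightarrow> 'y" and f
  assume D: "D \<in> D_all L"
    and g: "\<forall>d\<in>Field D. g d \<in> {f \<in> topspace X \<rightarrow>\<^sub>E topspace Y. lambda_borel_measurable L X Y f}"
    and f: "f \<in> topspace X \<rightarrow>\<^sub>E topspace Y"
    and lim: "\<forall>x\<in>topspace X. net_limit Y D (\<lambda>d. g d x) (f x)"
  have Dc: "|Field D| \<le>o L" and Dir: "directed_rel D" using D unfolding D_all_def by auto
  have sub: "{d'. (d, d') \<in> D} \<subseteq> Field D" for d by (auto simp: Field_def)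
  have ref: "(d, d) \<in> D" if "d \<in> Field D" for d
    using Dir that unfolding directed_rel_def preorder_on_def refl_on_def by blast
  have trans: "(a, c) \<in> D" if "(a, b) \<in> D" "(b, c) \<in> D" for a b c
    using Dir that unfolding directed_rel_def preorder_on_def trans_def by blast
  have dir: "\<exists>c. (a, c) \<in> D \<and> (b, c) \<in> D" if "a \<in> Field D" "b \<in> Field D" for a b
    using Dir that unfolding directed_rel_def by blast
  have "{x \<in> topspace X. f x \<in> U} \<in> lambda_borel_sets L X" if U: "openin Y U" for U
  proof -
    obtain \<B> where B: "|\<B>| \<le>o L"
        "\<And>B. B \<in> \<B> \<Longrightarrow> openin Y B \<and> (\<exists>C. closedin Y C \<and> B \<subseteq> C \<and> C \<subseteq> U)"
        "\<And>y. y \<in> U \<Longrightarrow> \<exists>B\<in>\<B>. y \<in> B"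
      using weight_le_regular_base[OF w reg U] by blast
    \<comment> \<open>These are the points that the net eventually maps into \<open>B\<close>.
      Reflexivity of \<open>D\<close> makes the inner intersections nonempty families.\<close>
    let ?E = "\<lambda>B. \<Union>d\<in>Field D. \<Inter>d'\<in>{d'. (d, d') \<in> D}. {x \<in> topspace X. g d' x \<in> B}"
    have "{x \<in> topspace X. g d x \<in> B} \<in> lambda_borel_sets L X"
      if "d \<in> Field D" "B \<in> \<B>" for d B
      using that g B(2) unfolding lambda_borel_measurable_def by blast
    moreover have "|{d'. (d, d') \<in> D}| \<le>o L" for d
      using card_of_mono1[OF sub] Dc ordLeq_transitive by blast
    ultimately have "(\<Union>B\<in>\<B>. ?E B) \<in> lambda_borel_sets L X"
      using sub ref by (intro lambda_borel_sets_UN[OF B(1)] lambda_borel_sets_UN[OF Dc]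
          lambda_borel_sets_INT) blast+
    moreover have "(\<Union>B\<in>\<B>. ?E B) = {x \<in> topspace X. f x \<in> U}"
    proof (intro subset_antisym subsetI)
      fix x assume "x \<in> (\<Union>B\<in>\<B>. ?E B)"
      then obtain B d where Bd: "B \<in> \<B>" "d \<in> Field D"
          "\<And>d'. (d, d') \<in> D \<Longrightarrow> x \<in> topspace X \<and> g d' x \<in> B"
        by blast
      then have x: "x \<in> topspace X" using ref by blast
      obtain C where C: "closedin Y C" "B \<subseteq> C" "C \<subseteq> U" using B(2) Bd(1) by blast
      \<comment> \<open>Otherwise the net would be eventually in \<open>B\<close> and eventually off
        \<open>C\<close>; a common upper bound of the two indices is contradictory.\<close>
      have "f x \<in> C"
      proof (rule ccontr)
        assume "f x \<notin> C"
        then have "openin Y (topspace Y - C)" "f x \<in> topspace Y - C" using C f x by auto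
        then obtain e where e: "e \<in> Field D" "\<And>d'. (e, d') \<in> D \<Longrightarrow> g d' x \<in> topspace Y - C"
          using lim x unfolding net_limit_def by blast
        obtain c where "(d, c) \<in> D" "(e, c) \<in> D" using dir Bd(2) e(1) by blast
        then show False using Bd(3) e(2) C(2) by blast
      qed
      then show "x \<in> {x \<in> topspace X. f x \<in> U}" using C(3) x by blast
    next
      fix x assume x: "x \<in> {x \<in> topspace X. f x \<in> U}"
      then obtain B where Bx: "B \<in> \<B>" "f x \<in> B" using B(3) by blast
      then have "openin Y B" using B(2) by blast
      moreover have "net_limit Y D (\<lambda>d. g d x) (f x)" using lim x by blast
      ultimately obtain d where "d \<in> Field D" "\<And>d'. (d, d') \<in> D \<Longrightarrow> g d' x \<in> B"
        using Bx(2) unfolding net_limit_def by meson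
      then show "x \<in> (\<Union>B\<in>\<B>. ?E B)" using Bx(1) x by blast
    qed
    ultimately show ?thesis by simp
  qed
  then show "f \<in> {f \<in> topspace X \<rightarrow>\<^sub>E topspace Y. lambda_borel_measurable L X Y f}"
    using f unfolding lambda_borel_measurable_def by blast
qed

lemma limit_closure_D_all_lambda_borel_measurable:
  assumes "weight_le Y L"
    and "\<And>U y. openin Y U \<Longrightarrow> y \<in> U \<Longrightarrow>
           \<exists>V C. openin Y V \<and> closedin Y C \<and> y \<in> V \<and> V \<subseteq> C \<and> C \<subseteq> U"
    and "f \<in> limit_closure X Y (D_all L) (continuous_functions X Y)"
  shows "lambda_borel_measurable L X Y f"
proof -
  have "continuous_functions X Y
          \<subseteq> {f \<in> topspace X \<rightarrow>\<^sub>E topspace Y. lambda_borel_measurable L X Y f}"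
    unfolding continuous_functions_def lambda_borel_measurable_def
    by (auto intro: lambda_borel_sets.intros(1) openin_continuous_map_preimage)
  from limit_closure_minimal[OF this limit_closed_lambda_borel_measurable] assms
  show ?thesis by blast
qed

text \<open>At each point the net is constant beyond the singleton of a suitable index, so it
  converges. All limits along \<open>Fin_rel L\<close> below are of this kind.\<close>

lemma limit_closed_Fin_eventually_eq:
  fixes L :: "'l rel"
  assumes cl: "limit_closed X Y (D_zero L) \<F>" and f: "f \<in> topspace X \<rightarrow>\<^sub>E topspace Y"
    and g: "\<And>s. finite s \<Longrightarrow> s \<subseteq> Field L \<Longrightarrow> g s \<in> \<F>"
    and ev: "\<And>x. x \<in> topspace X \<Longrightarrow>
      \<exists>i\<in>Field L. \<forall>s. i \<in> s \<and> finite s \<and> s \<subseteq> Field L \<longrightarrow> g s x = f x"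
  shows "f \<in> \<F>"
proof -
  have "net_limit Y (Fin_rel L) (\<lambda>s. g s x) (f x)" if x: "x \<in> topspace X" for x
    unfolding net_limit_def
  proof (intro conjI allI impI)
    show "f x \<in> topspace Y" using f x by auto
    fix U assume U: "openin Y U \<and> f x \<in> U"
    obtain i where i: "i \<in> Field L"
        "\<forall>s. i \<in> s \<and> finite s \<and> s \<subseteq> Field L \<longrightarrow> g s x = f x"
      using ev[OF x] by blast
    have "{i} \<in> Field (Fin_rel L)" unfolding Field_Fin_rel using i(1) by (simp add: Fpow_def)
    moreover have "g t x \<in> U" if "({i}, t) \<in> Fin_rel L" for t
    proof -
      have "i \<in> t \<and> finite t \<and> t \<subseteq> Field L" using that unfolding Fin_rel_def by blast
      then have "g t x = f x" using i(2) by blast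
      then show ?thesis using U by simp
    qed
    ultimately show "\<exists>s\<in>Field (Fin_rel L). \<forall>t. (s, t) \<in> Fin_rel L \<longrightarrow> g t x \<in> U" by blast
  qed
  moreover have "\<forall>s\<in>Field (Fin_rel L). g s \<in> \<F>"
    using g unfolding Field_Fin_rel Fpow_def by blast
  moreover have "Fin_rel L \<in> D_zero L" unfolding D_zero_def by blast
  ultimately show ?thesis by (intro limit_closedD[OF cl _ _ f]) auto
qed

section \<open>The closure contains all Borel functions\<close>

lemma ordLeq_image_Field:
  assumes "Card_order L" "|A| \<le>o L" "A \<noteq> {}"
  obtains e where "e ` Field L = A"
proof -
  have "|A| \<le>o |Field L|"
    by (rule ordLeq_ordIso_trans[OF assms(2) ordIso_symmetric[OF card_of_Field_ordIso[OF assms(1)]]])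
  then have "\<exists>e. e ` Field L = A" using card_of_ordLeq2[OF assms(3), of "Field L"] by simp
  then show thesis using that by auto
qed

section \<open>Gluing functions of the closure along Borel sets\<close>

context
  fixes L :: "'l rel" and X :: "'x topology" and Y :: "'y topology" and \<F> :: "('x \<Rightarrow> 'y) set"
  assumes L: "Cinfinite L"
    and wX: "weight_le X L"
    and clopen: "\<And>U x. openin X U \<Longrightarrow> x \<in> U \<Longrightarrow>
                   \<exists>V. openin X V \<and> closedin X V \<and> x \<in> V \<and> V \<subseteq> U"
  defines F: "\<F> \<equiv> limit_closure X Y (D_zero L) (continuous_functions X Y)"
begin

lemma closure_limit_closed: "limit_closed X Y (D_zero L) \<F>"
  unfolding F by (rule limit_closed_limit_closure)

lemma closure_funcset: "g \<in> \<F> \<Longrightarrow> g \<in> topspace X \<rightarrow>\<^sub>E topspace Y"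
  unfolding F by (rule subsetD[OF limit_closure_funcset])

lemma continuous_in_closure: "g \<in> continuous_functions X Y \<Longrightarrow> g \<in> \<F>"
  unfolding F by (rule subsetD[OF subset_limit_closure])

lemma piecewise_funcset:
  assumes "g \<in> topspace X \<rightarrow>\<^sub>E topspace Y" "h \<in> topspace X \<rightarrow>\<^sub>E topspace Y"
  shows "(\<lambda>x. if x \<in> A then g x else h x) \<in> topspace X \<rightarrow>\<^sub>E topspace Y"
proof (rule PiE_I)
  show "(if x \<in> A then g x else h x) \<in> topspace Y" if "x \<in> topspace X" for x
    using PiE_mem[OF assms(1) that] PiE_mem[OF assms(2) that] by simp
  show "(if x \<in> A then g x else h x) = undefined" if "x \<notin> topspace X" for x
    using PiE_arb[OF assms(1) that] PiE_arb[OF assms(2) that] by simp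
qed

lemma net_limit_const:
  assumes "D \<in> D_zero L" "y \<in> topspace Y"
  shows "net_limit Y D (\<lambda>_. y) y"
proof -
  have "D \<in> D_all L" using D_zero_subset_D_all[OF L] assms(1) by blast
  then have "Field D \<noteq> {}" by (simp add: D_all_def directed_rel_def)
  then show ?thesis using assms(2) by (auto simp: net_limit_def)
qed

text \<open>Gluing with a fixed \<open>h\<close> commutes with pointwise limits, since off
  \<open>A\<close> the net is constant. The \<open>g\<close> in the closure that can be glued thus
  form a limit closed collection, and it suffices to treat continuous \<open>g\<close>.\<close>

lemma piecewise_extend:
  assumes h: "h \<in> topspace X \<rightarrow>\<^sub>E topspace Y"
    and C: "\<And>g. g \<in> continuous_functions X Y \<Longrightarrow> (\<lambda>x. if x \<in> A then g x else h x) \<in> \<F>"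
    and g: "g \<in> \<F>"
  shows "(\<lambda>x. if x \<in> A then g x else h x) \<in> \<F>"
proof -
  let ?G = "{g \<in> \<F>. (\<lambda>x. if x \<in> A then g x else h x) \<in> \<F>}"
  have "limit_closed X Y (D_zero L) ?G"
    unfolding limit_closed_def
  proof (intro ballI allI impI, elim conjE)
    fix D k f assume D: "D \<in> D_zero L" and k: "\<forall>d\<in>Field D. k d \<in> ?G"
      and f: "f \<in> topspace X \<rightarrow>\<^sub>E topspace Y"
      and lim: "\<forall>x\<in>topspace X. net_limit Y D (\<lambda>d. k d x) (f x)"
    have "f \<in> \<F>"
      by (rule limit_closedD[OF closure_limit_closed D _ f, of k]) (use k lim in blast)+
    moreover have "(\<lambda>x. if x \<in> A then f x else h x) \<in> \<F>"
    proof (rule limit_closedD[OF closure_limit_closed D, of "\<lambda>d x. if x \<in> A then k d x else h x"])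
      show "(\<lambda>x. if x \<in> A then f x else h x) \<in> topspace X \<rightarrow>\<^sub>E topspace Y"
        by (rule piecewise_funcset[OF f h])
      show "(\<lambda>x. if x \<in> A then k d x else h x) \<in> \<F>" if "d \<in> Field D" for d
        using k that by blast
      show "net_limit Y D (\<lambda>d. if x \<in> A then k d x else h x) (if x \<in> A then f x else h x)"
        if "x \<in> topspace X" for x
        using lim net_limit_const[OF D PiE_mem[OF h that]] that by simp
    qed
    ultimately show "f \<in> ?G" by blast
  qed
  moreover have "continuous_functions X Y \<subseteq> ?G" using C continuous_in_closure by blast
  ultimately have "\<F> \<subseteq> ?G" unfolding F by (intro limit_closure_minimal)
  then show ?thesis using g by blast
qed

lemma piecewise_clopen:
  assumes A: "openin X A" "closedin X A" and g: "g \<in> \<F>" and h: "h \<in> \<F>"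
  shows "(\<lambda>x. if x \<in> A then g x else h x) \<in> \<F>"
proof -
  let ?C = "continuous_functions X Y"
  have C: "(\<lambda>x. if x \<in> A then g x else h x) \<in> ?C" if "g \<in> ?C" "h \<in> ?C" for g h
  proof -
    \<comment> \<open>With an empty frontier there is no matching condition where the two pieces
      meet.\<close>
    have fr: "X frontier_of A = {}" using A by (simp add: frontier_of_eq_empty closedin_subset)
    have g: "g \<in> topspace X \<rightarrow>\<^sub>E topspace Y" "continuous_map X Y g"
      and h: "h \<in> topspace X \<rightarrow>\<^sub>E topspace Y" "continuous_map X Y h"
      using that by (simp_all add: continuous_functions_def)
    have "continuous_map X Y (\<lambda>x. if x \<in> A then g x else h x)"
      by (rule continuous_map_cases)
        (use fr g(2) h(2) in \<open>simp_all add: continuous_map_from_subtopology\<close>)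
    then show ?thesis using piecewise_funcset[OF g(1) h(1)] by (simp add: continuous_functions_def)
  qed
  \<comment> \<open>\<open>piecewise_extend\<close> varies only the function on the set. Passing to
    the complement exchanges the roles, so both arguments can be extended in turn.\<close>
  have "(\<lambda>x. if x \<in> - A then h x else g x) \<in> \<F>"
  proof (rule piecewise_extend[OF closure_funcset[OF g] _ h])
    fix k assume k: "k \<in> ?C"
    have "(\<lambda>x. if x \<in> A then g x else k x) \<in> \<F>"
      by (rule piecewise_extend[OF closure_funcset[OF continuous_in_closure[OF k]] _ g])
        (use C k continuous_in_closure in blast)
    moreover have "(\<lambda>x. if x \<in> A then g x else k x) = (\<lambda>x. if x \<in> - A then k x else g x)" by auto
    ultimately show "(\<lambda>x. if x \<in> - A then k x else g x) \<in> \<F>" by simp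
  qed
  moreover have "(\<lambda>x. if x \<in> - A then h x else g x) = (\<lambda>x. if x \<in> A then g x else h x)" by auto
  ultimately show ?thesis by simp
qed

text \<open>Finite unions are glued by nested case distinctions. Along \<open>Fin_rel L\<close>, a
  point of the union has its final value once a set containing it is included.\<close>

lemma piecewise_Union:
  assumes card: "|\<A>| \<le>o L"
    and \<A>: "\<And>A g h. A \<in> \<A> \<Longrightarrow> g \<in> \<F> \<Longrightarrow> h \<in> \<F> \<Longrightarrow> (\<lambda>x. if x \<in> A then g x else h x) \<in> \<F>"
    and g: "g \<in> \<F>" and h: "h \<in> \<F>"
  shows "(\<lambda>x. if x \<in> \<Union>\<A> then g x else h x) \<in> \<F>"
proof (cases "\<A> = {}")
  case False
  with conjunct2[OF L] card obtain e where e: "e ` Field L = \<A>" by (rule ordLeq_image_Field)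
  have fin: "(\<lambda>x. if x \<in> \<Union>(e ` s) then g x else h x) \<in> \<F>" if "finite s" "s \<subseteq> Field L" for s
    using that
  proof (induction s)
    case (insert i s)
    have "(\<lambda>x. if x \<in> e i then g x else if x \<in> \<Union>(e ` s) then g x else h x) \<in> \<F>"
      using insert e g by (intro \<A>[of "e i" g]) auto
    moreover have "(\<lambda>x. if x \<in> e i then g x else if x \<in> \<Union>(e ` s) then g x else h x)
        = (\<lambda>x. if x \<in> \<Union>(e ` insert i s) then g x else h x)"
      by auto
    ultimately show ?case by simp
  qed (use h in simp)
  \<comment> \<open>This index serves for points outside the union, where every finite subfamily
    already gives \<open>h x\<close>.\<close>
  obtain i0 where i0: "i0 \<in> Field L" using L infinite_imp_nonempty unfolding cinfinite_def by blast
  show ?thesis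
  proof (rule limit_closed_Fin_eventually_eq[OF closure_limit_closed _ fin])
    show "(\<lambda>x. if x \<in> \<Union>\<A> then g x else h x) \<in> topspace X \<rightarrow>\<^sub>E topspace Y"
      by (intro piecewise_funcset closure_funcset g h)
    fix x
    show "\<exists>i\<in>Field L. \<forall>s. i \<in> s \<and> finite s \<and> s \<subseteq> Field L \<longrightarrow>
        (if x \<in> \<Union>(e ` s) then g x else h x) = (if x \<in> \<Union>\<A> then g x else h x)"
    proof (cases "x \<in> \<Union>\<A>")
      case True
      then obtain i where "i \<in> Field L" "x \<in> e i" using e by blast
      then show ?thesis using True by (intro bexI[of _ i]) auto
    next
      case False
      then show ?thesis using e i0 by (intro bexI[of _ i0]) auto
    qed
  qed auto
qed (use h in simp)

text \<open>There may be too many clopen subsets of \<open>U\<close>. Choosing one around each base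
  member that has one keeps their number at most that of the base.\<close>

lemma openin_Union_clopen:
  assumes U: "openin X U"
  obtains \<V> where "|\<V>| \<le>o L" "\<And>V. V \<in> \<V> \<Longrightarrow> openin X V \<and> closedin X V" "\<Union>\<V> = U"
proof -
  obtain \<B> where B: "|\<B>| \<le>o L" "\<And>U x. openin X U \<Longrightarrow> x \<in> U \<Longrightarrow> \<exists>B\<in>\<B>. x \<in> B \<and> B \<subseteq> U"
    using wX unfolding weight_le_def by metis
  let ?P = "\<lambda>B V. openin X V \<and> closedin X V \<and> B \<subseteq> V \<and> V \<subseteq> U"
  define v where "v = (\<lambda>B. SOME V. ?P B V)"
  let ?B = "{B \<in> \<B>. \<exists>V. ?P B V}"
  have v: "?P B (v B)" if "B \<in> ?B" for B
    using that someI_ex[of "?P B"] unfolding v_def by blast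
  have "|v ` ?B| \<le>o L"
    using card_of_image[of v ?B] card_of_mono1[of ?B \<B>] B(1) ordLeq_transitive by blast
  moreover have "\<Union>(v ` ?B) = U"
  proof (intro subset_antisym subsetI)
    fix x assume x: "x \<in> U"
    then obtain V where V: "openin X V" "closedin X V" "x \<in> V" "V \<subseteq> U" using clopen U by blast
    then obtain B where "B \<in> \<B>" "x \<in> B" "B \<subseteq> V" using B(2) by blast
    then have "B \<in> ?B" using V by blast
    then show "x \<in> \<Union>(v ` ?B)" using v \<open>x \<in> B\<close> by blast
  qed (use v in blast)
  moreover have "openin X V \<and> closedin X V" if "V \<in> v ` ?B" for V using v that by blast
  ultimately show thesis by (intro that[of "v ` ?B"])
qed

lemma piecewise_borel:
  assumes "A \<in> lambda_borel_sets L X" "g \<in> \<F>" "h \<in> \<F>"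
  shows "(\<lambda>x. if x \<in> A then g x else h x) \<in> \<F>"
  using assms
proof (induction arbitrary: g h rule: lambda_borel_sets.induct)
  case (1 U)
  obtain \<V> where "|\<V>| \<le>o L" "\<And>V. V \<in> \<V> \<Longrightarrow> openin X V \<and> closedin X V" "\<Union>\<V> = U"
    using openin_Union_clopen[OF 1(1)] by blast
  then show ?case using piecewise_Union[of \<V> g h] piecewise_clopen 1 by blast
next
  case (2 A)
  \<comment> \<open>Off the space both \<open>g\<close> and \<open>h\<close> are
    \<open>undefined\<close>, so swapping them is an equality of total functions.\<close>
  have "(\<lambda>x. if x \<in> topspace X - A then g x else h x) = (\<lambda>x. if x \<in> A then h x else g x)"
  proof
    fix x
    show "(if x \<in> topspace X - A then g x else h x) = (if x \<in> A then h x else g x)"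
      using PiE_arb[OF closure_funcset[OF 2(3)]] PiE_arb[OF closure_funcset[OF 2(4)]]
        lambda_borel_sets_subset[OF 2(1)]
      by (cases "x \<in> topspace X") auto
  qed
  then show ?case using 2 by simp
next
  case (3 \<A>)
  then show ?case by (intro piecewise_Union) auto
qed

section \<open>Borel functions with few values and approximation by them\<close>

lemma const_in_closure:
  assumes "y \<in> topspace Y"
  shows "(\<lambda>x\<in>topspace X. y) \<in> \<F>"
proof (rule continuous_in_closure)
  have "continuous_map X Y (\<lambda>x. y)" using assms by simp
  then have "continuous_map X Y (\<lambda>x\<in>topspace X. y)"
    by (rule continuous_map_eq) simp
  then show "(\<lambda>x\<in>topspace X. y) \<in> continuous_functions X Y"
    using assms unfolding continuous_functions_def by simp
qed

text \<open>Index the values by \<open>L\<close>. Keeping finitely many values and replacing the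
  others by a default means gluing constants along Borel fibres, and at each point this is
  eventually exact along \<open>Fin_rel L\<close>.\<close>

lemma borel_small_range_in_closure:
  assumes f: "f \<in> topspace X \<rightarrow>\<^sub>E topspace Y" and card: "|f ` topspace X| \<le>o L"
    and meas: "\<And>y. y \<in> topspace Y \<Longrightarrow> {x \<in> topspace X. f x = y} \<in> lambda_borel_sets L X"
  shows "f \<in> \<F>"
\<comment> \<open>On the empty space there are no values to index and no default, but
  \<open>f\<close> is trivially continuous.\<close>
proof (cases "topspace X = {}")
  case True
  then have "f \<in> continuous_functions X Y"
    using f by (simp add: continuous_functions_def continuous_map_def)
  then show ?thesis by (rule continuous_in_closure)
next
  case False
  then have "f ` topspace X \<noteq> {}" by simp
  with conjunct2[OF L] card obtain e where e: "e ` Field L = f ` topspace X"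
    by (rule ordLeq_image_Field)
  have eY: "e i \<in> topspace Y" if "i \<in> Field L" for i
  proof -
    have "e i \<in> f ` topspace X" using e that by blast
    then show ?thesis using PiE_mem[OF f] by auto
  qed
  obtain y0 where y0: "y0 \<in> topspace Y" using False PiE_mem[OF f] by blast
  define g where "g = (\<lambda>s. \<lambda>x\<in>topspace X. if f x \<in> e ` s then f x else y0)"
  have gF: "g s \<in> \<F>" if "finite s" "s \<subseteq> Field L" for s
    using that
  proof (induction s)
    case empty
    have "g {} = (\<lambda>x\<in>topspace X. y0)" by (auto simp: g_def restrict_def)
    then show ?case using const_in_closure[OF y0] by (simp only:)
  next
    case (insert i s)
    have i: "e i \<in> topspace Y" using eY insert by blast
    have "g (insert i s) = (\<lambda>x. if x \<in> {x \<in> topspace X. f x = e i}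
             then (\<lambda>x\<in>topspace X. e i) x else g s x)"
      by (auto simp: g_def restrict_def)
    then show ?case using piecewise_borel[OF meas[OF i] const_in_closure[OF i]] insert by simp
  qed
  show ?thesis
  proof (rule limit_closed_Fin_eventually_eq[OF closure_limit_closed f gF])
    fix x assume x: "x \<in> topspace X"
    then obtain i where "i \<in> Field L" "f x = e i" using e by (metis imageE imageI)
    then show "\<exists>i\<in>Field L. \<forall>s. i \<in> s \<and> finite s \<and> s \<subseteq> Field L \<longrightarrow> g s x = f x"
      using x by (intro bexI[of _ i]) (auto simp: g_def)
  qed auto
qed

lemma borel_approximation:
  fixes d :: "'y \<Rightarrow> 'y \<Rightarrow> 'g::linordered_field"
  assumes d: "induces_topology d Y" and wY: "weight_le Y L"
    and f: "f \<in> topspace X \<rightarrow>\<^sub>E topspace Y" and meas: "lambda_borel_measurable L X Y f"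
    and e: "0 < e"
  shows "\<exists>g\<in>\<F>. \<forall>x\<in>topspace X. d (f x) (g x) < e"
proof -
  obtain D where D: "D \<subseteq> topspace Y" "|D| \<le>o L"
      "\<And>U z. openin Y U \<Longrightarrow> z \<in> U \<Longrightarrow> \<exists>w\<in>D. w \<in> U"
    using weight_le_dense[OF wY] by blast
  have wo: "wo_rel |D|" unfolding wo_rel_def by (rule card_of_Well_order)
  define S where "S = (\<lambda>x. {w \<in> D. d (f x) w < e})"
  have fY: "f x \<in> topspace Y" if "x \<in> topspace X" for x using f that by auto
  have S: "S x \<subseteq> Field |D|" "S x \<noteq> {}" if "x \<in> topspace X" for x
  proof -
    have "f x \<in> {y \<in> topspace Y. d (f x) y < e}"
      using fY[OF that] e induces_topology_metric(2)[OF d, of "f x" "f x"] by simp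
    then show "S x \<noteq> {}"
      using D(3)[OF openin_induces_ball[OF d fY[OF that]]] unfolding S_def by blast
  qed (auto simp: S_def Field_card_of)
  define g where "g = (\<lambda>x\<in>topspace X. wo_rel.minim |D| (S x))"
  have gS: "g x \<in> S x" if "x \<in> topspace X" for x
    using wo_rel.minim_in[OF wo S[OF that]] that by (simp add: g_def)
  have least: "(g x, w) \<in> |D|" if "x \<in> topspace X" "w \<in> S x" for x w
    using wo_rel.minim_least[OF wo S(1)[OF that(1)] that(2)] that(1) by (simp add: g_def)
  let ?A = "\<lambda>w. {x \<in> topspace X. w \<in> S x}"
  have A: "?A w \<in> lambda_borel_sets L X" if w: "w \<in> D" for w
  proof -
    \<comment> \<open>By symmetry of \<open>d\<close>, closeness of \<open>w\<close> to
      \<open>f x\<close> means that \<open>f x\<close> lies in an open ball around the fixed point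
      \<open>w\<close>.\<close>
    have wY: "w \<in> topspace Y" using w D(1) by blast
    have "?A w = {x \<in> topspace X. f x \<in> {y \<in> topspace Y. d w y < e}}"
      using fY w wY induces_topology_metric(3)[OF d wY] unfolding S_def by auto
    moreover have "{x \<in> topspace X. f x \<in> {y \<in> topspace Y. d w y < e}} \<in> lambda_borel_sets L X"
      using meas openin_induces_ball[OF d wY] unfolding lambda_borel_measurable_def by blast
    ultimately show ?thesis by (simp only:)
  qed
  have "{x \<in> topspace X. g x = z} \<in> lambda_borel_sets L X" for z
  proof (cases "z \<in> D")
    case True
    have "underS |D| z \<subseteq> D" using underS_Field[of _ "|D|" z] unfolding Field_card_of by blast
    then have "(\<Union>w\<in>underS |D| z. ?A w) \<in> lambda_borel_sets L X"
      using A card_of_mono1 D(2) ordLeq_transitive by (intro lambda_borel_sets_UN) blast+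
    then have "?A z - (\<Union>w\<in>underS |D| z. ?A w) \<in> lambda_borel_sets L X"
      using A[OF True] L by (intro lambda_borel_sets_Diff)
    \<comment> \<open>The value is \<open>z\<close> exactly when \<open>z\<close> is close to
      \<open>f x\<close> and no earlier point of the dense set is.\<close>
    moreover have "{x \<in> topspace X. g x = z} = ?A z - (\<Union>w\<in>underS |D| z. ?A w)"
    proof (intro subset_antisym subsetI)
      fix x assume x: "x \<in> {x \<in> topspace X. g x = z}"
      have "w \<notin> S x" if w: "w \<in> underS |D| z" for w
      proof
        assume "w \<in> S x"
        then have "(z, w) \<in> |D|" using least x by blast
        then show False using w wo_rel.ANTISYM[OF wo] unfolding underS_def antisym_def by blast
      qed
      then show "x \<in> ?A z - (\<Union>w\<in>underS |D| z. ?A w)" using gS x by blast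
    next
      fix x assume x: "x \<in> ?A z - (\<Union>w\<in>underS |D| z. ?A w)"
      then have "(g x, z) \<in> |D|" "g x \<notin> underS |D| z" using least gS by blast+
      then show "x \<in> {x \<in> topspace X. g x = z}" using x unfolding underS_def by blast
    qed
    ultimately show ?thesis by simp
  next
    case False
    then have "{x \<in> topspace X. g x = z} = {}" using gS unfolding S_def by blast
    then show ?thesis using lambda_borel_sets.intros(1)[OF openin_empty] by metis
  qed
  moreover have "g \<in> topspace X \<rightarrow>\<^sub>E topspace Y"
    using gS D(1) unfolding S_def by (force simp: g_def)
  moreover have "|g ` topspace X| \<le>o L"
  proof -
    have "g ` topspace X \<subseteq> D" using gS unfolding S_def by blast
    then show ?thesis using card_of_mono1 D(2) ordLeq_transitive by blast
  qed
  ultimately have "g \<in> \<F>" by (intro borel_small_range_in_closure)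
  then show ?thesis using gS unfolding S_def by blast
qed

text \<open>Approximations within radii that tend to 0 along a regular cardinal converge, even
  uniformly.\<close>

lemma borel_in_closure:
  fixes d :: "'y \<Rightarrow> 'y \<Rightarrow> 'g::linordered_field"
  assumes d: "induces_topology d Y" and wY: "weight_le Y L"
    and cof: "cofinality (pos_reversed TYPE('g)) \<le>o L"
    and f: "f \<in> topspace X \<rightarrow>\<^sub>E topspace Y" and meas: "lambda_borel_measurable L X Y f"
  shows "f \<in> \<F>"
proof -
  have "Card_order L" using L by blast
  from regular_index_of_pos_reversed[OF this cof]
  obtain \<kappa> :: "'l set rel" and \<epsilon> :: "'l set \<Rightarrow> 'g" where \<kappa>: "\<kappa> \<in> D_zero L"
    and pos: "\<And>i. i \<in> Field \<kappa> \<Longrightarrow> 0 < \<epsilon> i"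
    and small: "\<And>e. 0 < e \<Longrightarrow> \<exists>i\<in>Field \<kappa>. \<forall>j. (i, j) \<in> \<kappa> \<longrightarrow> \<epsilon> j < e"
    by blast
  have "\<forall>i\<in>Field \<kappa>. \<exists>g\<in>\<F>. \<forall>x\<in>topspace X. d (f x) (g x) < \<epsilon> i"
    using borel_approximation[OF d wY f meas] pos by blast
  then obtain g where g: "\<And>i. i \<in> Field \<kappa> \<Longrightarrow> g i \<in> \<F>"
      "\<And>i x. i \<in> Field \<kappa> \<Longrightarrow> x \<in> topspace X \<Longrightarrow> d (f x) (g i x) < \<epsilon> i"
    by metis
  have "net_limit Y \<kappa> (\<lambda>i. g i x) (f x)" if x: "x \<in> topspace X" for x
    unfolding net_limit_def
  proof (intro conjI allI impI)
    show "f x \<in> topspace Y" using f x by auto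
    fix U assume "openin Y U \<and> f x \<in> U"
    then obtain e where e: "0 < e" "\<And>y. y \<in> topspace Y \<Longrightarrow> d (f x) y < e \<Longrightarrow> y \<in> U"
      unfolding openin_induces_topology[OF d] by blast
    obtain i where i: "i \<in> Field \<kappa>" "\<forall>j. (i, j) \<in> \<kappa> \<longrightarrow> \<epsilon> j < e" using small[OF e(1)] by blast
    have "g j x \<in> U" if j: "(i, j) \<in> \<kappa>" for j
    proof (rule e(2))
      have jF: "j \<in> Field \<kappa>" using j by (rule FieldI2)
      show "g j x \<in> topspace Y" using closure_funcset[OF g(1)[OF jF]] x by auto
      show "d (f x) (g j x) < e" using g(2)[OF jF x] i(2) j less_trans by blast
    qed
    then show "\<exists>i\<in>Field \<kappa>. \<forall>j. (i, j) \<in> \<kappa> \<longrightarrow> g j x \<in> U" using i(1) by blast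
  qed
  then show ?thesis by (intro limit_closedD[OF closure_limit_closed \<kappa> g(1) f])
qed

end

section \<open>The equivalence\<close>

text \<open>The part common to both cofinality cases, closing the cycle from Borel measurability
  through the two closures and back.\<close>

lemma equivalence_of_clopen_base:
  fixes L :: "'l rel" and d :: "'y \<Rightarrow> 'y \<Rightarrow> 'g::linordered_field"
  assumes L: "Cinfinite L" and wX: "weight_le X L"
    and clopen: "\<And>U x. openin X U \<Longrightarrow> x \<in> U \<Longrightarrow>
                   \<exists>V. openin X V \<and> closedin X V \<and> x \<in> V \<and> V \<subseteq> U"
    and d: "induces_topology d Y" and wY: "weight_le Y L"
    and cof: "cofinality (pos_reversed TYPE('g)) \<le>o L"
    and f: "f \<in> topspace X \<rightarrow>\<^sub>E topspace Y"
  shows "(lambda_borel_measurable L X Y f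
            \<longleftrightarrow> f \<in> limit_closure X Y (D_zero L) (continuous_functions X Y))
       \<and> (f \<in> limit_closure X Y (D_zero L) (continuous_functions X Y)
            \<longleftrightarrow> f \<in> limit_closure X Y (D_all L) (continuous_functions X Y))"
proof -
  have "f \<in> limit_closure X Y (D_zero L) (continuous_functions X Y)"
    if meas: "lambda_borel_measurable L X Y f"
    using L wX clopen d wY cof f meas by (rule borel_in_closure)
  moreover have "f \<in> limit_closure X Y (D_all L) (continuous_functions X Y)"
    if "f \<in> limit_closure X Y (D_zero L) (continuous_functions X Y)"
    using limit_closure_mono[OF D_zero_subset_D_all[OF L]] that by (rule subsetD)
  moreover have "lambda_borel_measurable L X Y f"
    if "f \<in> limit_closure X Y (D_all L) (continuous_functions X Y)"
    using wY induces_topology_regular[OF d] that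
    by (rule limit_closure_D_all_lambda_borel_measurable)
  ultimately show ?thesis by (intro conjI iffI) simp_all
qed

section \<open>Comparing cofinalities and splitting by the cofinality of the cardinal\<close>

lemma cofinality_Cinfinite:
  assumes L: "Cinfinite L"
  shows "cofinality L \<le>o L" "natLeq \<le>o cofinality L"
proof -
  have "cofinal (Field L) L"
    unfolding cofinal_def using Cinfinite_limit[OF _ L] by blast
  from cofinality_least[OF subset_refl this] obtain B
    where B: "B \<subseteq> Field L" "cofinal B L" "|B| = cofinality L"
      and le: "cofinality L \<le>o |Field L|" by blast
  show "cofinality L \<le>o L"
    using le L card_of_Field_ordIso ordLeq_ordIso_trans by blast
  \<comment> \<open>A finite subset of an infinite cardinal has a strict upper bound, so it is not
    cofinal.\<close>
  have "infinite B"
  proof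
    assume "finite B"
    then obtain y where y: "y \<in> Field L" "\<forall>x\<in>B. x \<noteq> y \<and> (x, y) \<in> L"
      using Cinfinite_limit_finite[OF _ B(1) L] by blast
    then obtain b where "b \<in> B" "(y, b) \<in> L" using B(2) unfolding cofinal_def by blast
    moreover have "antisym L" using L by (simp add: order_on_defs card_order_on_def)
    ultimately show False using y(2) unfolding antisym_def by blast
  qed
  then show "natLeq \<le>o cofinality L"
    unfolding B(3)[symmetric] using infinite_iff_natLeq_ordLeq by blast
qed

lemma cofinality_pos_reversed_real: "cofinality (pos_reversed TYPE(real)) \<le>o natLeq"
proof -
  let ?A = "range (\<lambda>n. inverse (real (Suc n)))"
  have "cofinal ?A (pos_reversed TYPE(real))"
    unfolding pos_reversed_cofinal using reals_Archimedean by fastforce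
  moreover have "?A \<subseteq> Field (pos_reversed TYPE(real))"
    unfolding pos_reversed_Field by auto
  ultimately have "cofinality (pos_reversed TYPE(real)) \<le>o |?A|" by (intro cofinality_least)
  then show ?thesis
    using card_of_image card_of_nat ordLeq_transitive ordLeq_ordIso_trans by blast
qed

text \<open>A countable set of positive elements is too small to be coinitial. This is the condition
  under which \<open>induces_topology_clopen_base\<close> applies.\<close>

lemma uncountable_cofinality_sequence_bound:
  fixes s :: "nat \<Rightarrow> 'g::linordered_field"
  assumes unc: "natLeq <o cofinality (pos_reversed TYPE('g))" and s: "\<And>n. 0 < s n"
  shows "\<exists>\<delta>>0. \<forall>n. \<delta> \<le> s n"
proof -
  have "|range s| \<le>o natLeq"
    using card_of_image card_of_nat ordLeq_ordIso_trans by blast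
  then have "|range s| <o cofinality (pos_reversed TYPE('g))"
    using unc ordLeq_ordLess_trans by blast
  moreover have "range s \<subseteq> Field (pos_reversed TYPE('g))"
    unfolding pos_reversed_Field using s by blast
  ultimately have "\<not> cofinal (range s) (pos_reversed TYPE('g))"
    using cofinality_least(2) not_ordLess_ordLeq by blast
  then obtain e where "0 < e" "\<forall>a\<in>range s. \<not> (0 < a \<and> a < e)"
    unfolding pos_reversed_cofinal by blast
  then show ?thesis using s by (metis not_less rangeI)
qed

theorem theorem4p5:
  fixes L :: "'l rel" and X :: "'x topology" and Y :: "'y topology"
    and f :: "'x \<Rightarrow> 'y"
  assumes "Card_order L" and "natLeq <o L" and "weak_power_two_eq L"
    and "natLeq <o cofinality L \<longrightarrow>
           cofinality (pos_reversed TYPE('g::linordered_field)) =o cofinality L"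
    and "class_M TYPE('g) L X" and "class_M TYPE('g) L Y"
    and "cofinality L =o natLeq \<longrightarrow> covering_dim X = 0"
    and "f \<in> topspace X \<rightarrow>\<^sub>E topspace Y"
  shows "(lambda_borel_measurable L X Y f
            \<longleftrightarrow> f \<in> limit_closure X Y (D_zero L) (continuous_functions X Y))
       \<and> (f \<in> limit_closure X Y (D_zero L) (continuous_functions X Y)
            \<longleftrightarrow> f \<in> limit_closure X Y (D_all L) (continuous_functions X Y))"
proof -
  have L: "Cinfinite L"
    using assms(1,2) ordLess_imp_ordLeq
    by (metis card_of_Field_ordIso cinfinite_def infinite_iff_natLeq_ordLeq ordIso_symmetric
        ordLeq_ordIso_trans)
  have w: "weight_le X L" "weight_le Y L" using assms(5,6) by (simp_all add: class_M_def)
  show ?thesis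
  proof (cases "cofinality L =o natLeq")
    case True
    then have metr: "metrizable_space X" "metrizable_space Y"
      using assms(5,6) by (simp_all add: class_M_def mu_metrizable_def)
    obtain d :: "'y \<Rightarrow> 'y \<Rightarrow> real" where d: "induces_topology d Y"
      using metrizable_space_imp_field_metrizable[OF metr(2)] unfolding field_metrizable_iff by blast
    have "covering_dim X = 0" "t1_space X"
      using assms(7) True metr(1) metrizable_imp_t1_space by auto
    note clopen = covering_dim_zero_clopen_base[OF this]
    have "cofinality (pos_reversed TYPE(real)) \<le>o L"
      using cofinality_pos_reversed_real assms(2) ordLeq_transitive ordLess_imp_ordLeq by blast
    from equivalence_of_clopen_base[OF L w(1) clopen d w(2) this assms(8)] show ?thesis .
  next
    case False
    \<comment> \<open>The cofinality is infinite, so if it is not countable it exceeds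
      \<open>natLeq\<close>.\<close>
    then have "natLeq <o cofinality L"
      using cofinality_Cinfinite(2)[OF L] ordLeq_iff_ordLess_or_ordIso ordIso_symmetric by blast
    then have cof: "cofinality (pos_reversed TYPE('g)) =o cofinality L"
      and unc: "natLeq <o cofinality (pos_reversed TYPE('g))"
      using assms(4) ordLess_ordIso_trans ordIso_symmetric by blast+
    obtain dX :: "'x \<Rightarrow> 'x \<Rightarrow> 'g" and dY :: "'y \<Rightarrow> 'y \<Rightarrow> 'g"
      where d: "induces_topology dX X" "induces_topology dY Y"
      using assms(5,6) False
      unfolding class_M_def mu_metrizable_def field_metrizable_iff by auto
    note clopen = induces_topology_clopen_base[OF d(1) uncountable_cofinality_sequence_bound[OF unc]]
    have "cofinality (pos_reversed TYPE('g)) \<le>o L"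
      using cof cofinality_Cinfinite(1)[OF L] ordIso_ordLeq_trans by blast
    from equivalence_of_clopen_base[OF L w(1) clopen d(2) w(2) this assms(8)] show ?thesis .
  qed
qed

end
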